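(* Let $n\ge2$. For all $A\in\mathcal{P}([n])$, the family $(\psi_\tau)_{\tau\in\mathcal{D}_A}$ is a basis of $W_A$, and $(\psi_\tau)_{\tau\in\mathfrak{S}_n}$ is a basis of $L(\mathfrak{S}_n)$.
   Context: Let $[n]=\{1,\dots,n\}$. For a finite set $E$, $\mathcal{P}(E)$ denotes the set of all subsets of $E$ with at least two elements, and $L(E)$ the real vector space of functions $E\to\mathbb{R}$; an element of $E$ is identified with its Dirac function in $L(E)$, and $\mathbf{1}_S$ is the indicator function of $S\subset E$. Words. An injective word over $[n]$ is a finite sequence $\omega=\omega_1\cdots\omega_k$ of distinct elements of $[n]$ ($0\le k\le n$, the empty word being allowed); its content is $c(\omega)=\{\omega_1,\dots,\omega_k\}$. $\Gamma_n$ is the set of all injective words over $[n]$, and $\Gamma(A)=\{\omega\in\Gamma_n : c(\omega)=A\}$ for $A\subset[n]$; $L(\Gamma(A))$ is viewed as a subspace of $L(\Gamma_n)$. As a domain of functions, the symmetric group $\mathfrak{S}_n$ is identified with $\Gamma([n])$ (a permutation $\sigma$ corresponds to the word $\sigma^{-1}(1)\cdots\sigma^{-1}(n)$). Spaces. For $a\in[n]$, the deletion operator $\varrho_a:L(\Gamma_n)\to L(\Gamma_n)$ is the linear map sending the Dirac function of a word $\pi$ to that of the word obtained from $\pi$ by deleting the letter $a$ if $a\in c(\pi)$, and to that of $\pi$ itself otherwise. For $A\in\mathcal{P}([n])$, $H_A=\{x\in L(\Gamma(A)) : \varrho_a(x)=0\text{ for all }a\in A\}$. For a word $\pi\in\Gamma_n$,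 $\mathfrak{S}_n[\pi]$ is the set of words $\sigma\in\Gamma([n])$ of the form $\sigma=\omega_1\pi\omega_2$ with $\omega_1,\omega_2\in\Gamma_n$. The linear operator $\phi_n:L(\Gamma_n)\to L(\mathfrak{S}_n)$ is defined on Dirac functions by $\phi_n\pi=\mathbf{1}_{\mathfrak{S}_n[\pi]}$, and $W_A:=\phi_n(H_A)$. Chains $x_\tau$. The concatenation product $(x,y)\mapsto xy$ on $L(\Gamma_n)$ is the bilinear map sending Dirac functions $(\pi,\pi')$ to the concatenated word $\pi\pi'$ if $c(\pi)\cap c(\pi')=\emptyset$ and to $0$ otherwise; $x\diamond y:=xy-yx$. For a permutation $\tau$ of $[n]$, $\mathrm{supp}(\tau)=\{i:\tau(i)\ne i\}$, and $\mathcal{D}_A=\{\tau\in\mathfrak{S}_n:\mathrm{supp}(\tau)=A\}$. A cycle $(a_1\dots a_m)$, $m\ge2$, maps $a_i\mapsto a_{i+1}$, $a_m\mapsto a_1$ and fixes the other elements. The standard cycle form of $\tau\neq id$ is its expression as a product of disjoint cycles of length $\ge2$, each cycle being written with its minimum element leftmost, and the cycles being arranged from left to right by increasing minimum element. For $\tau\in\mathcal{D}_A$, $A\in\mathcal{P}([n])$, the chain $x_\tau\in L(\Gamma(A))$ is the output of the following procedure. Write $\tau$ in standard cycle form and insert a symbol $\star$ between each two consecutive letters in each cycle. As long as a symbol $\star$ remains, take the $\star$ whose right-hand neighbor (the letter immediately to its right, ignoring parentheses) is largest; if it appears as $Q\star R$ between quantities $Q$ and $R$ (each a single letter or an already formed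 parenthesized expression), replace $Q\star R$ by $(Q\diamond R)$. When no $\star$ remains, the string, read as the concatenation product of the expressions coming from the successive cycles (a letter being the corresponding one-letter word), is $x_\tau$. For example $x_{(134)(25)}=(1\diamond(3\diamond4))(2\diamond5)$. Wavelets. $\psi_{id}=\mathbf{1}_{\mathfrak{S}_n}$, and $\psi_\tau=\phi_n(x_\tau)$ for $\tau\in\mathfrak{S}_n\setminus\{id\}$. *)

theory Defs
  imports "HOL-Analysis.Finite_Function_Topology" "HOL-Combinatorics.Cycles"
begin

text \<open>
  For finite \<open>E\<close>, the space $L(E)$ is the set of finitely supported functions \<open>'a \<Rightarrow>\<^sub>0 real\<close>
  that vanish outside \<open>E\<close>, so that all the spaces of functions on words live in the single real vector
  space \<open>nat list \<Rightarrow>\<^sub>0 real\<close>. Words are lists, the content of a word is its \<open>set\<close>, and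
  $L(\mathfrak{S}_n)$ is $L(\Gamma([n]))$.
\<close>

definition fun_space :: "'a set \<Rightarrow> ('a \<Rightarrow>\<^sub>0 real) set" where
  "fun_space E = {x. Poly_Mapping.keys x \<subseteq> E}"

definition dirac :: "'a \<Rightarrow> ('a \<Rightarrow>\<^sub>0 real)" where
  "dirac w = Poly_Mapping.single w 1"

definition indic :: "'a set \<Rightarrow> ('a \<Rightarrow>\<^sub>0 real)" where
  "indic S = (\<Sum>w\<in>S. dirac w)"

definition linear_ext :: "('a \<Rightarrow> 'v::real_vector) \<Rightarrow> ('a \<Rightarrow>\<^sub>0 real) \<Rightarrow> 'v" where
  "linear_ext g x = (\<Sum>w\<in>Poly_Mapping.keys x. Poly_Mapping.lookup x w *\<^sub>R g w)"

lemma linear_ext_dirac [simp]: "linear_ext g (dirac w) = g w"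
  by (simp add: linear_ext_def dirac_def)

lemma lookup_indic:
  assumes "finite S"
  shows "Poly_Mapping.lookup (indic S) w = indicator S w"
  using assms by (simp add: indic_def dirac_def lookup_sum lookup_single when_def indicator_def)

lemma lookup_scaleR_real: "Poly_Mapping.lookup (r *\<^sub>R x) w = r * Poly_Mapping.lookup (x :: 'a \<Rightarrow>\<^sub>0 real) w"
  by (simp add: scaleR_poly_mapping_def eq_onp_def)

lemma linear_linear_ext:
  fixes g :: "'a \<Rightarrow> 'v::real_vector"
  shows "linear (linear_ext g)"
proof -
  have mono: "linear_ext g x = (\<Sum>w\<in>K. Poly_Mapping.lookup x w *\<^sub>R g w)"
    if "finite K" "Poly_Mapping.keys x \<subseteq> K" for x K
    unfolding linear_ext_def
    by (rule sum.mono_neutral_left) (use that in \<open>auto simp: in_keys_iff\<close>)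
  show ?thesis
  proof (rule linearI)
    fix x y :: "'a \<Rightarrow>\<^sub>0 real"
    let ?K = "Poly_Mapping.keys x \<union> Poly_Mapping.keys y"
    have "Poly_Mapping.keys (x + y) \<subseteq> ?K" by (rule Poly_Mapping.keys_add)
    then show "linear_ext g (x + y) = linear_ext g x + linear_ext g y"
      by (simp add: mono[of ?K] lookup_add scaleR_add_left sum.distrib)
  next
    fix r :: real and x :: "'a \<Rightarrow>\<^sub>0 real"
    have "Poly_Mapping.keys (r *\<^sub>R x) \<subseteq> Poly_Mapping.keys x"
      by (auto simp: in_keys_iff lookup_scaleR_real)
    then show "linear_ext g (r *\<^sub>R x) = r *\<^sub>R linear_ext g x"
      by (simp add: mono[of "Poly_Mapping.keys x"] lookup_scaleR_real scaleR_sum_right)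
  qed
qed

definition basis_family :: "('i \<Rightarrow> 'v::real_vector) \<Rightarrow> 'i set \<Rightarrow> 'v set \<Rightarrow> bool" where
  "basis_family b I V \<longleftrightarrow> inj_on b I \<and> independent (b ` I) \<and> span (b ` I) = V"


section \<open>Injective words and the spaces $H_A$, $W_A$\<close>

definition inj_words :: "nat \<Rightarrow> nat list set" where
  "inj_words n = {w. distinct w \<and> set w \<subseteq> {1..n}}"

definition words_on :: "nat set \<Rightarrow> nat list set" where
  "words_on A = {w. distinct w \<and> set w = A}"

definition deletion :: "nat \<Rightarrow> (nat list \<Rightarrow>\<^sub>0 real) \<Rightarrow> (nat list \<Rightarrow>\<^sub>0 real)" where
  "deletion a = linear_ext (\<lambda>w. dirac (removeAll a w))"

definition H_space :: "nat set \<Rightarrow> (nat list \<Rightarrow>\<^sub>0 real) set" where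
  "H_space A = {x \<in> fun_space (words_on A). \<forall>a\<in>A. deletion a x = 0}"

definition perm_words_containing :: "nat \<Rightarrow> nat list \<Rightarrow> nat list set" where
  "perm_words_containing n w =
     {s \<in> words_on {1..n}. \<exists>u\<in>inj_words n. \<exists>v\<in>inj_words n. s = u @ w @ v}"

definition embed :: "nat \<Rightarrow> (nat list \<Rightarrow>\<^sub>0 real) \<Rightarrow> (nat list \<Rightarrow>\<^sub>0 real)" where
  "embed n = linear_ext (\<lambda>w. indic (perm_words_containing n w))"

definition W_space :: "nat \<Rightarrow> nat set \<Rightarrow> (nat list \<Rightarrow>\<^sub>0 real) set" where
  "W_space n A = embed n ` H_space A"

definition conc :: "(nat list \<Rightarrow>\<^sub>0 real) \<Rightarrow> (nat list \<Rightarrow>\<^sub>0 real) \<Rightarrow> (nat list \<Rightarrow>\<^sub>0 real)" where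
  "conc x y =
     linear_ext (\<lambda>u. linear_ext (\<lambda>v. if set u \<inter> set v = {} then dirac (u @ v) else 0) y) x"

definition diamond :: "(nat list \<Rightarrow>\<^sub>0 real) \<Rightarrow> (nat list \<Rightarrow>\<^sub>0 real) \<Rightarrow> (nat list \<Rightarrow>\<^sub>0 real)" where
  "diamond x y = conc x y - conc y x"


section \<open>Standard cycle form\<close>

definition supp :: "(nat \<Rightarrow> nat) \<Rightarrow> nat set" where
  "supp \<tau> = {i. \<tau> i \<noteq> i}"

definition perms_with_supp :: "nat \<Rightarrow> nat set \<Rightarrow> (nat \<Rightarrow> nat) set" where
  "perms_with_supp n A = {\<tau>. \<tau> permutes {1..n} \<and> supp \<tau> = A}"

definition is_standard_cycle_form :: "(nat \<Rightarrow> nat) \<Rightarrow> nat list list \<Rightarrow> bool" where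
  "is_standard_cycle_form \<tau> cs \<longleftrightarrow>
     \<tau> = foldr (\<circ>) (map cycle_of_list cs) id \<and>
     distinct (concat cs) \<and>
     (\<forall>c\<in>set cs. 2 \<le> length c \<and> hd c = Min (set c)) \<and>
     sorted_wrt (<) (map hd cs)"

definition standard_cycle_form :: "(nat \<Rightarrow> nat) \<Rightarrow> nat list list" where
  "standard_cycle_form \<tau> = (THE cs. is_standard_cycle_form \<tau> cs)"

lemma foldr_cycles_outside:
  "x \<notin> set (concat cs) \<Longrightarrow> foldr (\<circ>) (map cycle_of_list cs) id x = x"
  by (induction cs) (auto simp: id_outside_supp)

lemma foldr_cycles_inside:
  assumes "distinct (concat cs)" "c \<in> set cs" "x \<in> set c"
  shows "foldr (\<circ>) (map cycle_of_list cs) id x = cycle_of_list c x"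
  using assms
proof (induction cs)
  case (Cons d ds)
  have unfold: "foldr (\<circ>) (map cycle_of_list (d # ds)) id x =
      cycle_of_list d (foldr (\<circ>) (map cycle_of_list ds) id x)"
    by simp
  show ?case
  proof (cases "x \<in> set d")
    case True
    then have "x \<notin> set (concat ds)"
      using Cons.prems(1) by auto
    moreover from this True have "c = d"
      using Cons.prems by auto
    ultimately show ?thesis
      using foldr_cycles_outside[of x ds] unfolding unfold by metis
  next
    case False
    then have c: "c \<in> set ds"
      using Cons.prems by auto
    have "cycle c"
      using Cons.prems(1) c by (simp add: distinct_concat_iff)
    then have "cycle_of_list c x \<in> set c"
      using Cons.prems(3) by (metis cycle_is_surj imageI)
    then have "cycle_of_list c x \<notin> set d"
      using Cons.prems(1) c by auto
    moreover have "foldr (\<circ>) (map cycle_of_list ds) id x = cycle_of_list c x"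
      by (rule Cons.IH) (use Cons.prems c in auto)
    ultimately show ?thesis
      using id_outside_supp[of "cycle_of_list c x" d] unfolding unfold by metis
  qed
qed simp

lemma cycle_eq_support:
  assumes "cycle c" "c \<noteq> []" and \<tau>: "\<And>x. x \<in> set c \<Longrightarrow> \<tau> x = cycle_of_list c x"
  shows "support \<tau> (hd c) = c" and "range (\<lambda>i. (\<tau> ^^ i) (hd c)) = set c"
proof -
  let ?k = "length c"
  have k: "?k > 0" using assms(2) by simp
  have step: "\<tau> (c ! i) = c ! (Suc i mod ?k)" if "i < ?k" for i
  proof -
    have "map (cycle_of_list c) c = rotate1 c"
      using cyclic_rotation[OF assms(1), of 1] by simp
    then have "cycle_of_list c (c ! i) = rotate1 c ! i"
      using that by (metis nth_map)
    then show ?thesis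
      using that \<tau> by (simp add: nth_rotate1)
  qed
  have pow: "(\<tau> ^^ i) (hd c) = c ! (i mod ?k)" for i
  proof (induction i)
    case 0
    then show ?case using assms(2) by (simp add: hd_conv_nth)
  next
    case (Suc i)
    then show ?case using step[of "i mod ?k"] k by (simp add: mod_Suc_eq)
  qed
  have "least_power \<tau> (hd c) = ?k"
    unfolding least_power_def
  proof (rule Least_equality)
    show "(\<tau> ^^ ?k) (hd c) = hd c \<and> 0 < ?k"
      using k assms(2) pow[of ?k] by (simp add: hd_conv_nth)
  next
    fix j assume j: "(\<tau> ^^ j) (hd c) = hd c \<and> 0 < j"
    then have "c ! (j mod ?k) = c ! 0"
      using assms(2) pow[of j] by (simp add: hd_conv_nth)
    then have "j mod ?k = 0"
      using assms(1) k by (simp add: nth_eq_iff_index_eq)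
    then show "?k \<le> j"
      using j by (auto intro: dvd_imp_le)
  qed
  then show "support \<tau> (hd c) = c"
    by (intro nth_equalityI) (auto simp: pow)
  have "range (\<lambda>i. c ! (i mod ?k)) = (\<lambda>i. c ! i) ` {..<?k}"
  proof (intro equalityI subsetI)
    fix x assume "x \<in> (\<lambda>i. c ! i) ` {..<?k}"
    then obtain i where "i < ?k" "x = c ! i" by auto
    then have "x = c ! (i mod ?k)" by simp
    then show "x \<in> range (\<lambda>i. c ! (i mod ?k))" by blast
  qed (use k in auto)
  then show "range (\<lambda>i. (\<tau> ^^ i) (hd c)) = set c"
    by (auto simp: pow set_conv_nth)
qed

definition cycle_minima :: "(nat \<Rightarrow> nat) \<Rightarrow> nat set" where
  "cycle_minima \<tau> = {a. \<tau> a \<noteq> a \<and> (\<forall>i. a \<le> (\<tau> ^^ i) a)}"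

lemma is_standard_cycle_form_eq:
  assumes "is_standard_cycle_form \<tau> cs"
  shows "cs = map (support \<tau>) (sorted_list_of_set (cycle_minima \<tau>))"
proof -
  have \<tau>: "\<tau> = foldr (\<circ>) (map cycle_of_list cs) id" and dc: "distinct (concat cs)"
    and len: "\<And>c. c \<in> set cs \<Longrightarrow> 2 \<le> length c"
    and hd: "\<And>c. c \<in> set cs \<Longrightarrow> hd c = Min (set c)"
    and sorted: "sorted_wrt (<) (map hd cs)"
    using assms unfolding is_standard_cycle_form_def by auto
  have cyc: "cycle c" if "c \<in> set cs" for c
    using dc that by (simp add: distinct_concat_iff)
  have ne: "c \<noteq> []" if "c \<in> set cs" for c
    using len[OF that] by auto
  have in_c: "\<tau> x = cycle_of_list c x" if "c \<in> set cs" "x \<in> set c" for c x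
    using foldr_cycles_inside[OF dc that] \<tau> by simp
  note sup = cycle_eq_support[OF cyc ne in_c]
  have "set (map hd cs) = cycle_minima \<tau>"
  proof (intro equalityI subsetI)
    fix a assume "a \<in> set (map hd cs)"
    then obtain c where c: "c \<in> set cs" "a = hd c" by auto
    have "a \<le> (\<tau> ^^ i) a" for i
    proof -
      have "(\<tau> ^^ i) a \<in> set c"
        using sup(2)[OF c(1) c(1) c(1)] c(2) by auto
      then show ?thesis
        using hd[OF c(1)] c(2) by simp
    qed
    moreover have "\<tau> a \<noteq> a"
    proof
      assume "\<tau> a = a"
      then have "(\<tau> ^^ i) a = a" for i
        by (induction i) auto
      then have "set c = {a}"
        using sup(2)[OF c(1) c(1) c(1)] c(2) by auto
      then have "length c = 1"
        using cyc[OF c(1)] by (metis distinct_card is_singletonI is_singleton_altdef)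
      then show False
        using len[OF c(1)] by simp
    qed
    ultimately show "a \<in> cycle_minima \<tau>"
      by (simp add: cycle_minima_def)
  next
    fix a assume a: "a \<in> cycle_minima \<tau>"
    then have "a \<in> set (concat cs)"
      using foldr_cycles_outside[of a cs] \<tau> by (auto simp: cycle_minima_def)
    then obtain c where c: "c \<in> set cs" "a \<in> set c" by auto
    obtain i where i: "a = (\<tau> ^^ i) (hd c)"
      using sup(2)[OF c(1) c(1) c(1)] c(2) by (metis rangeE)
    have lp: "(\<tau> ^^ length c) (hd c) = hd c"
    proof -
      have "(\<tau> ^^ j) (hd c) = (cycle_of_list c ^^ j) (hd c) \<and> (\<tau> ^^ j) (hd c) \<in> set c" for j
        using ne[OF c(1)]
        by (induction j) (auto simp: in_c[OF c(1)] cycle_is_surj[OF cyc[OF c(1)]]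
             intro: cycle_permutes[THEN permutes_in_image, THEN iffD2])
      then show ?thesis
        using cycle_is_id_root[OF cyc[OF c(1)]] by simp
    qed
    have mult: "(\<tau> ^^ (length c * m)) (hd c) = hd c" for m
      by (induction m) (simp_all add: funpow_add lp)
    have "(\<tau> ^^ (length c * i - i)) a = (\<tau> ^^ (length c * i - i + i)) (hd c)"
      by (simp add: i funpow_add)
    also have "length c * i - i + i = length c * i"
      using ne[OF c(1)] by (simp add: Suc_le_eq)
    finally have "(\<tau> ^^ (length c * i - i)) a = hd c"
      using mult by simp
    then have "a \<le> hd c"
      using a by (auto simp: cycle_minima_def dest: spec[of _ "length c * i - i"])
    moreover have "hd c \<le> a"
      using hd[OF c(1)] c(2) by simp
    ultimately show "a \<in> set (map hd cs)"
      using c(1) by auto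
  qed
  then have "map hd cs = sorted_list_of_set (cycle_minima \<tau>)"
    using sorted by (metis sorted_list_of_set.idem_if_sorted_distinct strict_sorted_iff)
  moreover have "map (support \<tau>) (map hd cs) = cs"
    using sup(1) by (auto intro!: map_idI simp: o_def)
  ultimately show ?thesis by simp
qed

lemma standard_cycle_form_eqI:
  "is_standard_cycle_form \<tau> cs \<Longrightarrow> standard_cycle_form \<tau> = cs"
  unfolding standard_cycle_form_def
  by (rule the_equality) (auto dest: is_standard_cycle_form_eq)

lemma is_standard_cycle_form_standard_cycle_form:
  assumes "permutation \<tau>"
  shows "is_standard_cycle_form \<tau> (standard_cycle_form \<tau>)"
proof -
  define M where "M = cycle_minima \<tau>"
  define cs where "cs = map (support \<tau>) (sorted_list_of_set M)"
  have "finite {a. \<tau> a \<noteq> a}"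
    using assms by (simp add: permutation)
  then have fin: "finite M"
    unfolding M_def cycle_minima_def by (rule rev_finite_subset) auto
  have lp: "least_power \<tau> a > 0" for a
    by (rule least_power_of_permutation(2)[OF assms])
  have hd: "hd (support \<tau> a) = a" for a
    using lp[of a] by (simp add: hd_map)
  have self: "a \<in> set (support \<tau> a)" for a
    using lp[of a] by force
  have eqI: "a = b" if "a \<in> M" "b \<in> M" "a \<in> set (support \<tau> b)" for a b
  proof -
    have "b \<in> set (support \<tau> a)"
      using disjoint_support'[OF assms, of a b] disjoint_support'[OF assms, of b a] that(3) by blast
    with that(3) obtain i j where ij: "b = (\<tau> ^^ i) a" "a = (\<tau> ^^ j) b"
      by auto
    have "a \<le> (\<tau> ^^ i) a" "b \<le> (\<tau> ^^ j) b"
      using that(1,2) by (auto simp: M_def cycle_minima_def)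
    then show ?thesis
      unfolding ij(1)[symmetric] ij(2)[symmetric] by (rule antisym)
  qed
  have disj: "set (support \<tau> a) \<inter> set (support \<tau> b) = {}"
    if "a \<in> M" "b \<in> M" "a \<noteq> b" for a b
    using eqI[OF that(1,2)] that(3) disjoint_support'[OF assms, of a b] by blast
  have dc: "distinct (concat cs)"
    unfolding distinct_concat_iff
  proof (intro conjI allI ballI impI)
    have "inj_on (support \<tau>) M"
      by (rule inj_on_inverseI[where g = hd]) (rule hd)
    then have "distinct cs"
      unfolding cs_def by (simp add: distinct_map fin)
    then show "distinct (removeAll [] cs)"
      by (rule distinct_removeAll)
  next
    fix c assume "c \<in> set cs"
    then show "cycle c"
      using cycle_of_permutation[OF assms] by (auto simp: cs_def)
  next
    fix c d assume "c \<in> set cs \<and> d \<in> set cs \<and> c \<noteq> d"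
    then obtain a b where ab: "a \<in> M" "c = support \<tau> a" "b \<in> M" "d = support \<tau> b" "a \<noteq> b"
      unfolding cs_def by (auto simp: fin)
    show "set c \<inter> set d = {}"
      unfolding ab(2,4) by (rule disj[OF ab(1,3,5)])
  qed
  have prod: "\<tau> = foldr (\<circ>) (map cycle_of_list cs) id"
  proof
    fix x
    show "\<tau> x = foldr (\<circ>) (map cycle_of_list cs) id x"
    proof (cases "x \<in> set (concat cs)")
      case True
      then obtain a where a: "a \<in> M" "x \<in> set (support \<tau> a)"
        unfolding cs_def by (auto simp: fin)
      then have "support \<tau> a \<in> set cs"
        by (simp add: cs_def fin)
      from foldr_cycles_inside[OF dc this a(2)] show ?thesis
        using cycle_restrict[OF assms a(2)] by simp
    next
      case False
      have "\<tau> x = x"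
      proof (rule ccontr)
        assume x: "\<tau> x \<noteq> x"
        define a where "a = Min (set (support \<tau> x))"
        have "a \<in> set (support \<tau> x)"
          unfolding a_def by (rule Min_in) (use lp[of x] in auto)
        then have xa: "x \<in> set (support \<tau> a)" and ax: "a \<in> range (\<lambda>i. (\<tau> ^^ i) x)"
          using disjoint_support'[OF assms, of a x] disjoint_support'[OF assms, of x a]
          by (blast, metis support_set[OF assms])
        obtain i where i: "a = (\<tau> ^^ i) x" using ax by auto
        have "a \<le> (\<tau> ^^ j) a" for j
        proof -
          have "(\<tau> ^^ j) a = (\<tau> ^^ (j + i)) x" by (simp add: i funpow_add)
          then have "(\<tau> ^^ j) a \<in> set (support \<tau> x)"
            unfolding support_set[OF assms] by blast
          then show ?thesis unfolding a_def by (intro Min_le) auto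
        qed
        moreover have "\<tau> a \<noteq> a"
        proof
          assume "\<tau> a = a"
          then have "(\<tau> ^^ j) a = a" for j by (induction j) auto
          then have "x = a" using xa by auto
          with \<open>\<tau> a = a\<close> x show False by simp
        qed
        ultimately have "a \<in> M" by (simp add: M_def cycle_minima_def)
        then have "support \<tau> a \<in> set cs" by (simp add: cs_def fin)
        then have "x \<in> set (concat cs)" using xa unfolding set_concat by blast
        with False show False by blast
      qed
      then show ?thesis using foldr_cycles_outside[OF False] by simp
    qed
  qed
  have cyc: "2 \<le> length c \<and> hd c = Min (set c)" if "c \<in> set cs" for c
  proof -
    obtain a where a: "a \<in> M" and c: "c = support \<tau> a"
      using \<open>c \<in> set cs\<close> unfolding cs_def by (auto simp: fin)
    have "least_power \<tau> a > Suc 0"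
      by (rule least_power_gt_one[OF assms]) (use a in \<open>simp add: M_def cycle_minima_def\<close>)
    moreover have "Min (set (support \<tau> a)) = a"
      by (rule Min_eqI) (use a self[of a] in \<open>auto simp: M_def cycle_minima_def\<close>)
    ultimately show ?thesis
      unfolding c using hd[of a] by simp
  qed
  have "map hd cs = sorted_list_of_set M"
    unfolding cs_def map_map by (rule map_idI) (simp add: hd)
  then have "sorted_wrt (<) (map hd cs)"
    by (simp add: fin)
  then have "is_standard_cycle_form \<tau> cs"
    unfolding is_standard_cycle_form_def using prod dc cyc by blast
  then show ?thesis
    using standard_cycle_form_eqI by metis
qed


section \<open>The chains $x_\tau$ and the wavelets\<close>

datatype expr = Letter nat | Diamond expr expr

fun first_letter :: "expr \<Rightarrow> nat" where
  "first_letter (Letter a) = a"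
| "first_letter (Diamond Q R) = first_letter Q"

fun expr_chain :: "expr \<Rightarrow> (nat list \<Rightarrow>\<^sub>0 real)" where
  "expr_chain (Letter a) = dirac [a]"
| "expr_chain (Diamond Q R) = diamond (expr_chain Q) (expr_chain R)"

text \<open>
  A string is encoded as the list of its cycles, and a cycle $(Q_1 \star \cdots \star Q_k)$ as the list
  $[Q_1, \dots, Q_k]$: the symbols $\star$ are implicit between consecutive entries, and each of them is
  identified by its right-hand neighbour, the first letter of the entry that follows it.
\<close>

definition star_letters :: "expr list list \<Rightarrow> nat set" where
  "star_letters cs = (\<Union>c\<in>set cs. first_letter ` set (tl c))"

fun contract_star :: "nat \<Rightarrow> expr list \<Rightarrow> expr list" where
  "contract_star a (Q # R # es) =
     (if first_letter R = a then Diamond Q R # es else Q # contract_star a (R # es))"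
| "contract_star a es = es"

lemma length_contract_star:
  "length (contract_star a es) \<le> length es"
  "a \<in> first_letter ` set (tl es) \<Longrightarrow> length (contract_star a es) < length es"
  by (induction a es rule: contract_star.induct) auto

lemma sum_list_length_contract_star:
  assumes "a \<in> star_letters cs"
  shows "(\<Sum>c\<leftarrow>map (contract_star a) cs. length c) < (\<Sum>c\<leftarrow>cs. length c)"
  using assms
proof (induction cs)
  case (Cons c cs)
  have le: "(\<Sum>c\<leftarrow>cs. length (contract_star a c)) \<le> (\<Sum>c\<leftarrow>cs. length c)"
    by (intro sum_list_mono length_contract_star)
  show ?case
  proof (cases "a \<in> first_letter ` set (tl c)")
    case True
    then show ?thesis
      using le length_contract_star(2)[of a c] by (simp add: o_def)
  next
    case False
    then show ?thesis
      using Cons length_contract_star(1)[of a c] by (simp add: o_def star_letters_def)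
  qed
qed (simp add: star_letters_def)

lemma finite_star_letters: "finite (star_letters cs)"
  by (simp add: star_letters_def)

function contract_stars :: "expr list list \<Rightarrow> expr list list" where
  "contract_stars cs =
     (if star_letters cs = {} then cs
      else contract_stars (map (contract_star (Max (star_letters cs))) cs))"
  by pat_completeness auto
termination
  by (relation "measure (\<lambda>cs. \<Sum>c\<leftarrow>cs. length c)")
     (use sum_list_length_contract_star Max_in finite_star_letters in auto)

declare contract_stars.simps [simp del]

definition x_chain :: "(nat \<Rightarrow> nat) \<Rightarrow> (nat list \<Rightarrow>\<^sub>0 real)" where
  "x_chain \<tau> =
     foldr conc
       (map expr_chain (concat (contract_stars (map (map Letter) (standard_cycle_form \<tau>)))))
       (dirac [])"

lemma conc_dirac_Nil: "conc x (dirac []) = x"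
proof -
  have "conc x (dirac []) = (\<Sum>w\<in>Poly_Mapping.keys x. Poly_Mapping.lookup x w *\<^sub>R dirac w)"
    by (simp add: conc_def linear_ext_def[of _ x])
  also have "\<dots> = x"
    by (rule poly_mapping_eqI)
       (simp add: lookup_sum lookup_scaleR_real dirac_def lookup_single when_def in_keys_iff
          if_distrib[of "(*) _"] cong: if_cong)
  finally show ?thesis .
qed

lemma x_chain_example:
  assumes "\<tau> = cycle_of_list [1, 3, 4] \<circ> cycle_of_list [2, 5]"
  shows "x_chain \<tau> =
           conc (diamond (dirac [1]) (diamond (dirac [3]) (dirac [4]))) (diamond (dirac [2]) (dirac [5]))"
proof -
  have scf: "standard_cycle_form \<tau> = [[1, 3, 4], [2, 5]]"
    by (rule standard_cycle_form_eqI) (simp add: is_standard_cycle_form_def assms)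
  have "contract_stars (map (map Letter) [[1, 3, 4], [2, 5]]) =
          [[Diamond (Letter 1) (Diamond (Letter 3) (Letter 4))], [Diamond (Letter 2) (Letter 5)]]"
    by (subst contract_stars.simps, simp add: star_letters_def)+
  then show ?thesis
    by (simp add: x_chain_def scf conc_dirac_Nil)
qed

definition wavelet :: "nat \<Rightarrow> (nat \<Rightarrow> nat) \<Rightarrow> (nat list \<Rightarrow>\<^sub>0 real)" where
  "wavelet n \<tau> = (if \<tau> = id then indic (words_on {1..n}) else embed n (x_chain \<tau>))"

end

theory Submission
  imports Defs "HOL-Combinatorics.Multiset_Permutations"
begin

text \<open>
  There are $n!$ wavelets and $L(\mathfrak{S}_n)$ has dimension $n!$, so it suffices to prove the
  wavelets linearly independent and then to locate the elements of $W_A$ in the resulting basis. Two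
  independent mechanisms are at work.

  The first separates different supports. Let \<open>restriction B\<close> delete from every word the letters outside
  $B$. For $h \in H_A$, a word occurring in $\phi_n h$ consists of a word of $h$ with letters of the
  complement of $A$ written around it, in a way that does not depend on the word of $h$. If some letter
  $a \in A$ is missing from $B$, then restricting to $B$ factors through $\varrho_a$ and gives zero
  (\<open>restriction_embed_eq_0\<close>); if $B = A$, only the surrounding letters disappear and $h$ comes back up to
  a positive factor (\<open>restriction_embed_self\<close>). Applied to a linear combination of wavelets by induction
  on the support, restriction to $B$ therefore leaves a multiple of
  $\sum_{\tau \in \mathcal{D}_B} c_\tau x_\tau$.

  The second separates permutations with the same support, by triangularity of the chains $x_\tau$. Words
  are compared lexicographically after reversal, that is, from right to left. In a bracketed expression
  produced by the contraction procedure every product $Q \diamond R$ satisfies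
  $\mathrm{first}(Q) < \mathrm{first}(R)$, because the star with the largest right-hand neighbour is
  contracted first and every cycle starts with its minimum. Hence the smallest word of
  $Q \diamond R = QR - RQ$ comes from $RQ$, and the smallest word of the whole expression is the reversed
  cycle (\<open>leading_word_expr_chain\<close>). The smallest word of $x_\tau$, read backwards, is the concatenation of
  the cycles of $\tau$ by decreasing minimum; as in Foata's fundamental bijection the cycles can be
  recovered from it, each new cycle starting at a new left-to-right minimum (\<open>inj_on_chain_word\<close>). Distinct
  leading words make the $x_\tau$ independent.

  Finally, for $h \in H_A$ expand $\phi_n h$ in the wavelet basis. Restriction to any $B \not\supseteq A$
  kills $\phi_n h$, so the coefficients of all $\tau$ with support strictly inside $A$ vanish, and restriction
  to $A$ then exhibits $h$ as a combination of the $x_\tau$, $\tau \in \mathcal{D}_A$.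
\<close>

section \<open>Linear extension and families of vectors\<close>

lemma linear_ext_linear_compose:
  assumes "linear f"
  shows "f (linear_ext g x) = linear_ext (\<lambda>w. f (g w)) x"
  using assms by (simp add: linear_ext_def linear_sum linear_scale)

lemma linear_ext_dirac_compose:
  "linear_ext g (linear_ext (\<lambda>w. dirac (r w)) x) = linear_ext (\<lambda>w. g (r w)) x"
  by (simp add: linear_ext_linear_compose[OF linear_linear_ext])

lemma linear_ext_cong:
  assumes "x \<in> fun_space E" "\<And>w. w \<in> E \<Longrightarrow> f w = g w"
  shows "linear_ext f x = linear_ext g x"
  unfolding linear_ext_def by (rule sum.cong) (use assms in \<open>auto simp: fun_space_def\<close>)

lemma linear_ext_scaleR_dirac: "linear_ext (\<lambda>w. r *\<^sub>R dirac w) x = r *\<^sub>R x"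
  by (rule poly_mapping_eqI)
     (simp add: linear_ext_def lookup_sum lookup_scaleR_real dirac_def lookup_single when_def
        in_keys_iff if_distrib[of "(*) _"] cong: if_cong)

lemma linear_ext_dirac_eq: "linear_ext dirac x = x"
  using linear_ext_scaleR_dirac[of 1] by simp

lemma fun_spaceI: "(\<And>w. Poly_Mapping.lookup x w \<noteq> 0 \<Longrightarrow> w \<in> E) \<Longrightarrow> x \<in> fun_space E"
  by (auto simp: fun_space_def in_keys_iff)

lemma fun_spaceD: "x \<in> fun_space E \<Longrightarrow> Poly_Mapping.lookup x w \<noteq> 0 \<Longrightarrow> w \<in> E"
  by (auto simp: fun_space_def in_keys_iff)

lemma subspace_fun_space: "subspace (fun_space E)"
proof (rule subspaceI)
  show "x + y \<in> fun_space E" if "x \<in> fun_space E" "y \<in> fun_space E" for x y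
    using that Poly_Mapping.keys_add[of x y] by (auto simp: fun_space_def)
  show "r *\<^sub>R x \<in> fun_space E" if "x \<in> fun_space E" for r x
    using that by (auto simp: fun_space_def in_keys_iff lookup_scaleR_real)
qed (simp add: fun_space_def)

lemma dirac_in_fun_space: "w \<in> E \<Longrightarrow> dirac w \<in> fun_space E"
  by (simp add: fun_space_def dirac_def)

lemma indic_in_fun_space: "S \<subseteq> E \<Longrightarrow> indic S \<in> fun_space E"
  unfolding indic_def by (intro subspace_sum subspace_fun_space dirac_in_fun_space) auto

lemma span_dirac: "span (dirac ` E) = fun_space E"
proof
  show "span (dirac ` E) \<subseteq> fun_space E"
    by (intro span_minimal subspace_fun_space) (auto intro: dirac_in_fun_space)
  show "fun_space E \<subseteq> span (dirac ` E)"
  proof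
    fix x assume "x \<in> fun_space E"
    then have "linear_ext dirac x \<in> span (dirac ` E)"
      unfolding linear_ext_def
      by (intro span_sum span_scale span_base) (auto simp: fun_space_def)
    then show "x \<in> span (dirac ` E)"
      by (simp add: linear_ext_dirac_eq)
  qed
qed

lemma independent_familyI:
  fixes b :: "'i \<Rightarrow> 'v::real_vector"
  assumes "finite I"
    and indep: "\<And>c i. (\<Sum>i\<in>I. c i *\<^sub>R b i) = 0 \<Longrightarrow> i \<in> I \<Longrightarrow> c i = 0"
  shows "inj_on b I" and "independent (b ` I)"
proof -
  show inj: "inj_on b I"
  proof (rule inj_onI, rule ccontr)
    fix i j assume ij: "i \<in> I" "j \<in> I" "b i = b j" "i \<noteq> j"
    define c :: "'i \<Rightarrow> real" where "c = (\<lambda>k. if k = i then 1 else if k = j then -1 else 0)"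
    have "(\<Sum>k\<in>I. c k *\<^sub>R b k) = (\<Sum>k\<in>{i, j}. c k *\<^sub>R b k)"
      by (rule sum.mono_neutral_right) (use assms(1) ij in \<open>auto simp: c_def\<close>)
    also have "\<dots> = 0"
      using ij by (simp add: c_def)
    finally have "c i = 0"
      using indep ij by blast
    then show False
      by (simp add: c_def)
  qed
  show "independent (b ` I)"
  proof (rule independent_if_scalars_zero)
    fix f v assume f: "(\<Sum>v\<in>b ` I. f v *\<^sub>R v) = 0" and v: "v \<in> b ` I"
    have "(\<Sum>i\<in>I. f (b i) *\<^sub>R b i) = 0"
      using f by (simp add: sum.reindex[OF inj])
    then show "f v = 0"
      using indep[of "\<lambda>i. f (b i)"] v by auto
  qed (use assms(1) in simp)
qed

text \<open>
  An exchange argument: adding to $S$ an element of $T$ outside its span would produce an independent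
  set larger than the spanning set $T$.
\<close>

lemma span_eq_if_card_le:
  fixes S T :: "'v::real_vector set"
  assumes "finite T" "independent S" "S \<subseteq> span T" "card T \<le> card S"
  shows "span S = span T"
proof
  show "span S \<subseteq> span T"
    using assms(3) by (rule span_minimal) simp
  have "T \<subseteq> span S"
  proof (rule subsetI, rule ccontr)
    fix v assume v: "v \<in> T" "v \<notin> span S"
    have "finite S"
      using independent_span_bound[OF assms(1-3)] by simp
    have "independent (insert v S)"
      using assms(2) v(2) by (simp add: independent_insert)
    moreover have "insert v S \<subseteq> span T"
      using assms(3) v(1) by (simp add: span_base)
    ultimately have "card (insert v S) \<le> card T"
      using independent_span_bound[OF assms(1)] by blast
    moreover have "v \<notin> S"
      using v(2) span_base by blast
    ultimately show False
      using assms(4) \<open>finite S\<close> by simp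
  qed
  then show "span T \<subseteq> span S"
    by (rule span_minimal) simp
qed


section \<open>Concatenation of chains with disjoint contents\<close>

lemma length_words_on: "w \<in> words_on A \<Longrightarrow> length w = card A"
  using distinct_card by (fastforce simp: words_on_def)

lemma finite_words_on: "finite A \<Longrightarrow> finite (words_on A)"
  using finite_subset_distinct[of A] by (rule rev_finite_subset) (auto simp: words_on_def)

text \<open>
  All words of $x$ have the same length, so a word splits in at most one way into a word of $x$ followed
  by a word of $y$; no cancellation can occur.
\<close>

lemma lookup_conc:
  assumes x: "x \<in> fun_space (words_on A)" and y: "y \<in> fun_space (words_on B)" and disj: "A \<inter> B = {}"
  shows "Poly_Mapping.lookup (conc x y) w =
    Poly_Mapping.lookup x (take (card A) w) * Poly_Mapping.lookup y (drop (card A) w)"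
proof -
  let ?l = Poly_Mapping.lookup and ?k = "card A"
  have "conc x y = linear_ext (\<lambda>u. linear_ext (\<lambda>v. dirac (u @ v)) y) x"
    unfolding conc_def
    by (intro linear_ext_cong[OF x] linear_ext_cong[OF y]) (use disj in \<open>auto simp: words_on_def\<close>)
  then have "?l (conc x y) w = (\<Sum>u\<in>Poly_Mapping.keys x. \<Sum>v\<in>Poly_Mapping.keys y.
      ?l x u * (?l y v * (if u @ v = w then 1 else 0)))"
    by (simp add: linear_ext_def lookup_sum lookup_scaleR_real dirac_def lookup_single when_def
        sum_distrib_left)
  also have "\<dots> = (\<Sum>u\<in>Poly_Mapping.keys x. \<Sum>v\<in>Poly_Mapping.keys y.
      (if u = take ?k w then ?l x u else 0) * (if v = drop ?k w then ?l y v else 0))"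
  proof (intro sum.cong refl)
    fix u v assume "u \<in> Poly_Mapping.keys x"
    then have "length u = ?k"
      using x length_words_on by (auto simp: fun_space_def)
    then have "u @ v = w \<longleftrightarrow> u = take ?k w \<and> v = drop ?k w"
      by auto
    then show "?l x u * (?l y v * (if u @ v = w then 1 else 0)) =
        (if u = take ?k w then ?l x u else 0) * (if v = drop ?k w then ?l y v else 0)"
      by simp
  qed
  also have "\<dots> = ?l x (take ?k w) * ?l y (drop ?k w)"
    by (simp add: sum_product[symmetric] in_keys_iff)
  finally show ?thesis .
qed

lemma conc_in_fun_space:
  assumes x: "x \<in> fun_space (words_on A)" and y: "y \<in> fun_space (words_on B)" and disj: "A \<inter> B = {}"
  shows "conc x y \<in> fun_space (words_on (A \<union> B))"
proof (rule fun_spaceI)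
  fix w assume "Poly_Mapping.lookup (conc x y) w \<noteq> 0"
  then have "take (card A) w \<in> words_on A" "drop (card A) w \<in> words_on B"
    using fun_spaceD[OF x] fun_spaceD[OF y] by (auto simp: lookup_conc[OF assms])
  then have "take (card A) w @ drop (card A) w \<in> words_on (A \<union> B)"
    using disj unfolding words_on_def mem_Collect_eq distinct_append set_append by blast
  then show "w \<in> words_on (A \<union> B)"
    by simp
qed

lemma diamond_in_fun_space:
  assumes "x \<in> fun_space (words_on A)" "y \<in> fun_space (words_on B)" "A \<inter> B = {}"
  shows "diamond x y \<in> fun_space (words_on (A \<union> B))"
  using conc_in_fun_space[OF assms] conc_in_fun_space[OF assms(2,1)] assms(3)
  by (simp add: diamond_def subspace_diff subspace_fun_space Un_commute Int_commute)

lemma conc_zero [simp]: "conc 0 y = 0" "conc x 0 = 0"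
  by (simp_all add: conc_def linear_ext_def)

lemma conc_Nil_left: "conc (dirac []) y = y"
  by (simp add: conc_def linear_ext_dirac_eq)

lemma linear_deletion: "linear (deletion a)"
  by (simp add: deletion_def linear_linear_ext)

text \<open>
  Disjointness of $A$ and $B$ matters: for overlapping contents the product of two words is zero,
  whereas it may become nonzero once the common letter has been deleted.
\<close>

lemma deletion_conc:
  assumes x: "x \<in> fun_space (words_on A)" and y: "y \<in> fun_space (words_on B)" and disj: "A \<inter> B = {}"
  shows "deletion a (conc x y) = conc (deletion a x) (deletion a y)"
proof -
  have "deletion a (conc x y) = linear_ext (\<lambda>u. linear_ext (\<lambda>v.
      deletion a (if set u \<inter> set v = {} then dirac (u @ v) else 0)) y) x"
    by (simp add: conc_def linear_ext_linear_compose[OF linear_deletion])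
  also have "\<dots> = linear_ext (\<lambda>u. linear_ext (\<lambda>v.
      if set (removeAll a u) \<inter> set (removeAll a v) = {} then dirac (removeAll a u @ removeAll a v)
      else 0) y) x"
    by (intro linear_ext_cong[OF x] linear_ext_cong[OF y])
       (use disj in \<open>auto simp: words_on_def deletion_def\<close>)
  also have "\<dots> = conc (deletion a x) (deletion a y)"
    by (simp add: conc_def deletion_def linear_ext_dirac_compose)
  finally show ?thesis .
qed


section \<open>Leading words\<close>

text \<open>
  The leading word is recorded in reversed form, so that the comparison from right to left becomes the
  ordinary lexicographic order.
\<close>

definition leading_word :: "(nat list \<Rightarrow>\<^sub>0 real) \<Rightarrow> nat list \<Rightarrow> bool" where
  "leading_word x w \<longleftrightarrow> Poly_Mapping.lookup x (rev w) \<noteq> 0 \<and>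
     (\<forall>u. Poly_Mapping.lookup x u \<noteq> 0 \<longrightarrow> rev u = w \<or> (w, rev u) \<in> lex less_than)"

lemma leading_word_dirac: "leading_word (dirac w) (rev w)"
  by (auto simp: leading_word_def dirac_def lookup_single when_def)

lemma leading_word_conc:
  assumes x: "x \<in> fun_space (words_on A)" and y: "y \<in> fun_space (words_on B)" and disj: "A \<inter> B = {}"
    and lx: "leading_word x v" and ly: "leading_word y w"
  shows "leading_word (conc x y) (w @ v)"
  unfolding leading_word_def
proof (intro conjI allI impI)
  have "rev v \<in> words_on A"
    using fun_spaceD[OF x] lx by (simp add: leading_word_def)
  then have v: "card A = length v"
    using length_words_on by fastforce
  then show "Poly_Mapping.lookup (conc x y) (rev (w @ v)) \<noteq> 0"
    using lx ly by (simp add: lookup_conc[OF x y disj] leading_word_def)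
  fix u assume "Poly_Mapping.lookup (conc x y) u \<noteq> 0"
  then have nz: "Poly_Mapping.lookup x (take (card A) u) \<noteq> 0" "Poly_Mapping.lookup y (drop (card A) u) \<noteq> 0"
    by (auto simp: lookup_conc[OF x y disj])
  define p q where "p = take (card A) u" and "q = drop (card A) u"
  have len: "length p = length v"
    using length_words_on[OF fun_spaceD[OF x nz(1)]] v by (simp add: p_def)
  have "rev p = v \<or> (v, rev p) \<in> lex less_than" "rev q = w \<or> (w, rev q) \<in> lex less_than"
    using lx ly nz by (auto simp: leading_word_def p_def q_def)
  then have "rev q @ rev p = w @ v \<or> (w @ v, rev q @ rev p) \<in> lex less_than"
    using len by (auto intro: lex_append_leftI lex_append_rightI)
  then show "rev u = w @ v \<or> (w @ v, rev u) \<in> lex less_than"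
    by (simp add: p_def q_def flip: rev_append)
qed

text \<open>
  The order of the two arguments reflects $Q \diamond R = QR - RQ$: the subtracted product has the smaller
  leading word.
\<close>

lemma leading_word_diff:
  assumes lx: "leading_word x w'" and ly: "leading_word y w" and less: "(w, w') \<in> lex less_than"
  shows "leading_word (x - y) w"
  unfolding leading_word_def
proof (intro conjI allI impI)
  have tr: "trans (lex less_than)"
    by (rule lex_transI) simp
  have irr: "(w, w) \<notin> lex less_than"
    using wf_lex[OF wf_less_than] by (meson wf_not_refl)
  have x: "(w, rev u) \<in> lex less_than" if "Poly_Mapping.lookup x u \<noteq> 0" for u
    using lx that less transD[OF tr less] unfolding leading_word_def by blast
  have "Poly_Mapping.lookup x (rev w) = 0"
    using x[of "rev w"] irr by auto
  then show "Poly_Mapping.lookup (x - y) (rev w) \<noteq> 0"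
    using ly by (simp add: leading_word_def lookup_minus)
  fix u assume "Poly_Mapping.lookup (x - y) u \<noteq> 0"
  then have "Poly_Mapping.lookup x u \<noteq> 0 \<or> Poly_Mapping.lookup y u \<noteq> 0"
    by (auto simp: lookup_minus)
  then show "rev u = w \<or> (w, rev u) \<in> lex less_than"
    using x ly unfolding leading_word_def by blast
qed

text \<open>
  Among the indices with nonzero coefficient take one with minimal leading word. All other chains
  involved have larger leading words, hence that word occurs in no other term.
\<close>

lemma independent_if_leading_words:
  assumes "finite I" and lead: "\<And>i. i \<in> I \<Longrightarrow> leading_word (x i) (w i)" and inj: "inj_on w I"
    and zero: "(\<Sum>i\<in>I. c i *\<^sub>R x i) = 0" and "i \<in> I"
  shows "c i = 0"
proof (rule ccontr)
  define J where "J = {i \<in> I. c i \<noteq> 0}"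
  assume "c i \<noteq> 0"
  then have "w i \<in> w ` J"
    using \<open>i \<in> I\<close> by (auto simp: J_def)
  then obtain m where m: "m \<in> w ` J" "\<And>v. (v, m) \<in> lex less_than \<Longrightarrow> v \<notin> w ` J"
    by (rule wfE_min[OF wf_lex[OF wf_less_than]]) blast
  then obtain j where j: "j \<in> I" "c j \<noteq> 0" "m = w j"
    by (auto simp: J_def)
  have "c k * Poly_Mapping.lookup (x k) (rev m) = 0" if "k \<in> I" "k \<noteq> j" for k
  proof (cases "c k = 0")
    case False
    then have "(w k, m) \<notin> lex less_than"
      using m(2) that(1) by (auto simp: J_def)
    moreover have "w k \<noteq> m"
      using inj j that by (auto dest: inj_onD)
    ultimately show ?thesis
      using lead[OF that(1)] unfolding leading_word_def by (metis mult_eq_0_iff rev_rev_ident)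
  qed simp
  then have "(\<Sum>k\<in>I - {j}. c k * Poly_Mapping.lookup (x k) (rev m)) = 0"
    by (intro sum.neutral) blast
  then have "(\<Sum>k\<in>I. c k * Poly_Mapping.lookup (x k) (rev m)) = c j * Poly_Mapping.lookup (x j) (rev m)"
    using \<open>finite I\<close> j(1) by (simp add: sum.remove[of _ j])
  moreover have "(\<Sum>k\<in>I. c k * Poly_Mapping.lookup (x k) (rev m)) = 0"
    using arg_cong[OF zero, of "\<lambda>x. Poly_Mapping.lookup x (rev m)"]
    by (simp add: lookup_sum lookup_scaleR_real)
  ultimately show False
    using j lead[OF j(1)] by (simp add: leading_word_def)
qed


section \<open>Bracketed expressions\<close>

fun letters :: "expr \<Rightarrow> nat list" where
  "letters (Letter a) = [a]"
| "letters (Diamond Q R) = letters Q @ letters R"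

text \<open>
  The invariant of the contraction procedure. It forces every product $RQ$ to have a smaller reversed
  leading word than $QR$. The standard bracketings of Lyndon words with distinct letters have it.
\<close>

fun increasing :: "expr \<Rightarrow> bool" where
  "increasing (Letter a) = True"
| "increasing (Diamond Q R) \<longleftrightarrow> increasing Q \<and> increasing R \<and> first_letter Q < first_letter R"

lemma letters_Cons: "\<exists>as. letters e = first_letter e # as"
  by (induction e) auto

lemma first_letter_in_letters: "first_letter e \<in> set (letters e)"
  using letters_Cons[of e] by auto

lemma expr_chain_in_fun_space:
  "distinct (letters e) \<Longrightarrow> expr_chain e \<in> fun_space (words_on (set (letters e)))"
proof (induction e)
  case (Letter a)
  then show ?case
    by (auto intro: dirac_in_fun_space simp: words_on_def)
qed (simp add: diamond_in_fun_space)

text \<open>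
  Writing $q$ and $r$ for the letter sequences of $Q$ and $R$, the products $QR$ and $RQ$ have reversed
  leading words $rq$ and $qr$. Since $q$ starts with the smaller letter, $qr < rq$, and the leading word
  of $RQ$ survives in the difference.
\<close>

lemma leading_word_expr_chain:
  "distinct (letters e) \<Longrightarrow> increasing e \<Longrightarrow> leading_word (expr_chain e) (letters e)"
proof (induction e)
  case (Letter a)
  show ?case
    using leading_word_dirac[of "[a]"] by simp
next
  case (Diamond Q R)
  have Q: "distinct (letters Q)" and R: "distinct (letters R)"
    and disj: "set (letters Q) \<inter> set (letters R) = {}" and disj': "set (letters R) \<inter> set (letters Q) = {}"
    using Diamond.prems(1) by auto
  have lQ: "leading_word (expr_chain Q) (letters Q)" and lR: "leading_word (expr_chain R) (letters R)"
    using Diamond Q R by auto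
  have "(letters Q @ letters R, letters R @ letters Q) \<in> lex less_than"
    using letters_Cons[of Q] letters_Cons[of R] Diamond.prems(2) by auto
  moreover note leading_word_conc[OF expr_chain_in_fun_space[OF Q] expr_chain_in_fun_space[OF R] disj lQ lR]
  moreover note leading_word_conc[OF expr_chain_in_fun_space[OF R] expr_chain_in_fun_space[OF Q] disj' lR lQ]
  ultimately show ?case
    by (simp add: diamond_def leading_word_diff)
qed

text \<open>
  Deleting $a$ turns the one-letter chain $a$ into the empty word, the unit of concatenation, and the unit
  commutes with everything; so the innermost diamond containing $a$ vanishes, and with it all those around
  it.
\<close>

lemma deletion_expr_chain:
  assumes "distinct (letters e)" "2 \<le> length (letters e)" "a \<in> set (letters e)"
  shows "deletion a (expr_chain e) = 0"
  using assms
proof (induction e)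
  case (Diamond Q R)
  have Q: "distinct (letters Q)" and R: "distinct (letters R)"
    and disj: "set (letters Q) \<inter> set (letters R) = {}" and disj': "set (letters R) \<inter> set (letters Q) = {}"
    using Diamond.prems(1) by auto
  have del: "deletion a (expr_chain (Diamond Q R)) =
      diamond (deletion a (expr_chain Q)) (deletion a (expr_chain R))"
    using deletion_conc[OF expr_chain_in_fun_space[OF Q] expr_chain_in_fun_space[OF R] disj]
      deletion_conc[OF expr_chain_in_fun_space[OF R] expr_chain_in_fun_space[OF Q] disj']
    by (simp add: diamond_def linear_diff[OF linear_deletion])
  have one: "deletion a (expr_chain e) = 0 \<or> deletion a (expr_chain e) = dirac []"
    if "a \<in> set (letters e)" "2 \<le> length (letters e) \<Longrightarrow> deletion a (expr_chain e) = 0" for e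
  proof (cases e)
    case (Letter b)
    then show ?thesis
      using that(1) by (simp add: deletion_def)
  next
    case (Diamond S T)
    then have "2 \<le> length (letters e)"
      using letters_Cons[of S] letters_Cons[of T] by auto
    then show ?thesis
      using that(2) by simp
  qed
  consider "a \<in> set (letters Q)" "a \<notin> set (letters R)" | "a \<in> set (letters R)" "a \<notin> set (letters Q)"
    using Diamond.prems(3) disj by auto
  then show ?case
  proof cases
    case 1
    then show ?thesis
      unfolding del using one[OF 1(1)] Diamond.IH(1)[OF Q _ 1(1)]
      by (auto simp: diamond_def conc_Nil_left conc_dirac_Nil)
  next
    case 2
    then show ?thesis
      unfolding del using one[OF 2(1)] Diamond.IH(2)[OF R _ 2(1)]
      by (auto simp: diamond_def conc_Nil_left conc_dirac_Nil)
  qed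
qed simp

abbreviation product_chain :: "expr list \<Rightarrow> (nat list \<Rightarrow>\<^sub>0 real)" where
  "product_chain es \<equiv> foldr conc (map expr_chain es) (dirac [])"

lemma product_chain_in_fun_space:
  "distinct (concat (map letters es)) \<Longrightarrow>
    product_chain es \<in> fun_space (words_on (set (concat (map letters es))))"
proof (induction es)
  case Nil
  show ?case
    by (simp add: dirac_in_fun_space words_on_def)
next
  case (Cons e es)
  then show ?case
    using conc_in_fun_space[OF expr_chain_in_fun_space, of e "product_chain es" "set (concat (map letters es))"]
    by auto
qed

lemma leading_word_product_chain:
  "distinct (concat (map letters es)) \<Longrightarrow> (\<forall>e\<in>set es. increasing e) \<Longrightarrow>
    leading_word (product_chain es) (concat (rev (map letters es)))"
proof (induction es)
  case Nil
  show ?case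
    using leading_word_dirac[of "[]"] by simp
next
  case (Cons e es)
  then show ?case
    using leading_word_conc[OF expr_chain_in_fun_space product_chain_in_fun_space, of e es]
      leading_word_expr_chain[of e]
    by auto
qed

lemma deletion_product_chain:
  "distinct (concat (map letters es)) \<Longrightarrow> \<forall>e\<in>set es. 2 \<le> length (letters e) \<Longrightarrow>
    a \<in> set (concat (map letters es)) \<Longrightarrow> deletion a (product_chain es) = 0"
proof (induction es)
  case (Cons e es)
  have "deletion a (product_chain (e # es)) = conc (deletion a (expr_chain e)) (deletion a (product_chain es))"
    using deletion_conc[OF expr_chain_in_fun_space product_chain_in_fun_space, of e es] Cons.prems(1) by auto
  then show ?case
    using Cons deletion_expr_chain[of e a] by (cases "a \<in> set (letters e)") auto
qed simp


section \<open>The contraction procedure\<close>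

lemma letters_contract_star: "concat (map letters (contract_star a es)) = concat (map letters es)"
  by (induction a es rule: contract_star.induct) auto

text \<open>
  The left-hand neighbour of the contracted star is either the initial entry, covered by the first
  assumption, or the right-hand neighbour of an earlier star that has not been contracted, whose first
  letter is at most $a$ and different from $a$.
\<close>

lemma increasing_contract_star:
  assumes "tl es \<noteq> [] \<Longrightarrow> first_letter (hd es) < a" "\<forall>e\<in>set (tl es). first_letter e \<le> a"
    and "\<forall>e\<in>set es. increasing e"
  shows "\<forall>e\<in>set (contract_star a es). increasing e"
  using assms by (induction a es rule: contract_star.induct) auto

lemma star_letter_greater:
  assumes "distinct c" "hd c = Min (set c)" "concat (map letters d) = c" "e \<in> set (tl d)"
  shows "first_letter (hd d) < first_letter e"
proof -
  obtain f d' where d: "d = f # d'"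
    using assms(4) by (cases d) auto
  obtain as where f: "letters f = first_letter f # as"
    using letters_Cons by blast
  have e: "first_letter e \<in> set (concat (map letters d'))"
    using assms(4) d first_letter_in_letters by auto
  have "first_letter f = Min (set c)"
    using assms(2,3) d f by auto
  moreover have "Min (set c) \<le> first_letter e"
    using assms(3) e d by (intro Min_le) auto
  moreover have "first_letter f \<noteq> first_letter e"
    using assms(1,3) d f e by auto
  ultimately show ?thesis
    using d by simp
qed

text \<open>
  The largest star letter of the whole string bounds the star letters of each cycle, so every contraction
  can be analysed cycle by cycle.
\<close>

lemma contract_stars_invariant:
  assumes cs: "\<forall>c\<in>set cs. distinct c \<and> hd c = Min (set c)"
    and "list_all2 (\<lambda>c d. concat (map letters d) = c \<and> (\<forall>e\<in>set d. increasing e)) cs ds"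
  shows "list_all2 (\<lambda>c d. concat (map letters d) = c \<and> (\<forall>e\<in>set d. increasing e)) cs (contract_stars ds)
     \<and> star_letters (contract_stars ds) = {}"
  using assms(2)
proof (induction ds rule: contract_stars.induct)
  case (1 ds)
  show ?case
  proof (cases "star_letters ds = {}")
    case True
    then show ?thesis
      using 1(2) by (simp add: contract_stars.simps)
  next
    case False
    define a where "a = Max (star_letters ds)"
    have "concat (map letters (contract_star a d)) = c \<and> (\<forall>e\<in>set (contract_star a d). increasing e)"
      if c: "c \<in> set cs" and d: "d \<in> set ds"
        and cd: "concat (map letters d) = c \<and> (\<forall>e\<in>set d. increasing e)" for c d
    proof -
      have le: "\<forall>e\<in>set (tl d). first_letter e \<le> a"
        using d unfolding a_def
        by (auto intro!: Max_ge finite_star_letters simp: star_letters_def)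
      have "first_letter (hd d) < a" if ne: "tl d \<noteq> []"
      proof -
        have "hd (tl d) \<in> set (tl d)"
          using ne by simp
        moreover from this have "first_letter (hd d) < first_letter (hd (tl d))"
          using star_letter_greater[of c d] c cd cs by blast
        ultimately show ?thesis
          using le by fastforce
      qed
      then show ?thesis
        using increasing_contract_star[of d a] le cd by (simp add: letters_contract_star)
    qed
    then have "list_all2 (\<lambda>c d. concat (map letters d) = c \<and> (\<forall>e\<in>set d. increasing e)) cs
        (map (contract_star a) ds)"
      unfolding list.rel_map using 1(2) by (rule list.rel_mono_strong[rotated]) blast
    then show ?thesis
      using 1(1)[OF False] False by (subst (1 2) contract_stars.simps) (simp add: a_def)
  qed
qed

text \<open>
  When no star is left, every cycle has become a single expression, so flattening the result loses
  nothing.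
\<close>

lemma concat_contract_stars:
  assumes "\<forall>c\<in>set cs. distinct c \<and> c \<noteq> [] \<and> hd c = Min (set c)"
  defines "es \<equiv> concat (contract_stars (map (map Letter) cs))"
  shows "map letters es = cs" and "\<forall>e\<in>set es. increasing e"
proof -
  let ?P = "\<lambda>c d. concat (map letters d) = c \<and> (\<forall>e\<in>set d. increasing e)"
  define ds where "ds = contract_stars (map (map Letter) cs)"
  have "concat (map (letters \<circ> Letter) c) = c" for c
    by (induction c) auto
  then have "list_all2 ?P cs (map (map Letter) cs)"
    unfolding list.rel_map by (intro list.rel_refl_strong) auto
  then have *: "list_all2 ?P cs ds \<and> star_letters ds = {}"
    unfolding ds_def by (rule contract_stars_invariant[rotated]) (use assms(1) in auto)
  then have tl: "\<forall>d\<in>set ds. tl d = []"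
    by (auto simp: star_letters_def)
  have "list_all2 ?P cs ds" using * by simp
  then have "map letters (concat ds) = cs \<and> (\<forall>e\<in>set (concat ds). increasing e)"
    using tl assms(1)
  proof (induction rule: list_all2_induct)
    case (Cons c cs d ds)
    then obtain e where "d = [e]"
      by (cases d) auto
    with Cons show ?case
      by simp
  qed simp
  then show "map letters es = cs" "\<forall>e\<in>set es. increasing e"
    by (simp_all add: es_def ds_def)
qed


section \<open>The chains of permutations\<close>

lemma standard_cycle_formD:
  assumes "is_standard_cycle_form \<tau> cs"
  shows "\<forall>c\<in>set cs. distinct c \<and> c \<noteq> [] \<and> hd c = Min (set c)" and "supp \<tau> = set (concat cs)"
proof -
  have dist: "distinct (concat cs)" and len: "\<forall>c\<in>set cs. 2 \<le> length c" and "\<forall>c\<in>set cs. hd c = Min (set c)"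
    and \<tau>: "\<tau> = foldr (\<circ>) (map cycle_of_list cs) id"
    using assms by (auto simp: is_standard_cycle_form_def)
  then show "\<forall>c\<in>set cs. distinct c \<and> c \<noteq> [] \<and> hd c = Min (set c)"
    by (fastforce simp: distinct_concat_iff)
  have "\<tau> x \<noteq> x" if x: "c \<in> set cs" "x \<in> set c" for c x
  proof -
    have c: "cycle c"
      using dist x(1) by (simp add: distinct_concat_iff)
    obtain i where i: "i < length c" "x = c ! i"
      using x(2) by (metis in_set_conv_nth)
    have "map (cycle_of_list c) c = rotate1 c"
      using cyclic_rotation[OF c, of 1] by simp
    then have "cycle_of_list c x = c ! (Suc i mod length c)"
      using i by (metis nth_map nth_rotate1)
    moreover have "c ! (Suc i mod length c) \<noteq> c ! i"
      using i c len x(1) by (subst nth_eq_iff_index_eq) (auto simp: mod_Suc)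
    ultimately show ?thesis
      using foldr_cycles_inside[OF dist x] \<tau> i(2) by simp
  qed
  then show "supp \<tau> = set (concat cs)"
    using foldr_cycles_outside[of _ cs] unfolding supp_def \<tau> set_concat by blast
qed

text \<open>
  The first block is the longest prefix whose letters are at least the very first letter, because the
  second block starts with a smaller one.
\<close>

lemma decreasing_blocks_unique:
  fixes cs ds :: "nat list list"
  assumes "concat cs = concat ds"
    and "\<forall>c\<in>set cs. c \<noteq> [] \<and> hd c = Min (set c)" "\<forall>d\<in>set ds. d \<noteq> [] \<and> hd d = Min (set d)"
    and "sorted_wrt (>) (map hd cs)" "sorted_wrt (>) (map hd ds)"
  shows "cs = ds"
  using assms
proof (induction cs arbitrary: ds)
  case Nil
  then show ?case
    by (cases ds) auto
next
  case (Cons c cs)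
  have block: "takeWhile (\<lambda>x. hd (concat (c # cs)) \<le> x) (concat (c # cs)) = c"
    if "\<forall>c\<in>set (c # cs). c \<noteq> [] \<and> hd c = Min (set c)" "sorted_wrt (>) (map hd (c # cs))" 
    for c :: "nat list" and cs
  proof -
    have hd: "hd (concat (c # cs)) = hd c"
      using that(1) by simp
    have "takeWhile (\<lambda>x. hd c \<le> x) (concat cs) = []"
    proof (cases cs)
      case (Cons c' cs')
      then have "takeWhile (\<lambda>x. hd c \<le> x) (hd c' # tl c' @ concat cs') = []"
        using that(2) by simp
      moreover have "concat cs = hd c' # tl c' @ concat cs'"
        using that(1) Cons by (cases c') auto
      ultimately show ?thesis
        by metis
    qed simp
    moreover have "\<forall>x\<in>set c. hd c \<le> x"
      using that(1) by simp
    ultimately show ?thesis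
      unfolding hd by simp
  qed
  obtain d ds' where ds: "ds = d # ds'"
    using Cons.prems(1,2) by (cases ds) auto
  have "c = d"
    using block[of c cs] block[of d ds'] Cons.prems unfolding ds by metis
  moreover have "cs = ds'"
    using Cons.prems \<open>c = d\<close> ds by (intro Cons.IH) auto
  ultimately show ?case
    using ds by simp
qed

definition chain_word :: "(nat \<Rightarrow> nat) \<Rightarrow> nat list" where
  "chain_word \<tau> = concat (rev (standard_cycle_form \<tau>))"

lemma inj_on_chain_word: "inj_on chain_word {\<tau>. permutation \<tau>}"
proof (rule inj_onI)
  fix \<sigma> \<tau> assume "\<sigma> \<in> {\<tau>. permutation \<tau>}" "\<tau> \<in> {\<tau>. permutation \<tau>}" and eq: "chain_word \<sigma> = chain_word \<tau>"
  then have \<sigma>: "is_standard_cycle_form \<sigma> (standard_cycle_form \<sigma>)"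
    and \<tau>: "is_standard_cycle_form \<tau> (standard_cycle_form \<tau>)"
    by (simp_all add: is_standard_cycle_form_standard_cycle_form)
  have "rev (standard_cycle_form \<sigma>) = rev (standard_cycle_form \<tau>)"
    using eq standard_cycle_formD(1)[OF \<sigma>] standard_cycle_formD(1)[OF \<tau>] \<sigma> \<tau>
    by (intro decreasing_blocks_unique)
       (auto simp: chain_word_def is_standard_cycle_form_def sorted_wrt_rev simp flip: rev_map)
  then show "\<sigma> = \<tau>"
    using \<sigma> \<tau> by (simp add: is_standard_cycle_form_def)
qed

lemma
  assumes "permutation \<tau>"
  shows x_chain_in_H_space: "x_chain \<tau> \<in> H_space (supp \<tau>)" and leading_word_x_chain: "leading_word (x_chain \<tau>) (chain_word \<tau>)"
proof -
  define cs where "cs = standard_cycle_form \<tau>"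
  define es where "es = concat (contract_stars (map (map Letter) cs))"
  have scf: "is_standard_cycle_form \<tau> cs"
    unfolding cs_def using assms by (rule is_standard_cycle_form_standard_cycle_form)
  note D = standard_cycle_formD[OF scf]
  have es: "map letters es = cs" "\<forall>e\<in>set es. increasing e"
    using concat_contract_stars[OF D(1)] by (simp_all add: es_def)
  have x: "x_chain \<tau> = product_chain es"
    by (simp add: x_chain_def es_def cs_def)
  have dist: "distinct (concat (map letters es))"
    using scf by (simp add: es(1) is_standard_cycle_form_def)
  have len: "\<forall>e\<in>set es. 2 \<le> length (letters e)"
    using scf es(1) by (auto simp: is_standard_cycle_form_def)
  have supp: "supp \<tau> = set (concat (map letters es))"
    by (simp add: D(2) es(1))
  show "x_chain \<tau> \<in> H_space (supp \<tau>)"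
    using product_chain_in_fun_space[OF dist] deletion_product_chain[OF dist len]
    unfolding x H_space_def supp by blast
  show "leading_word (x_chain \<tau>) (chain_word \<tau>)"
    using leading_word_product_chain[OF dist es(2)] by (simp add: x chain_word_def cs_def es(1))
qed

lemma x_chain_id: "x_chain id = dirac []"
proof -
  have "standard_cycle_form id = []"
    by (rule standard_cycle_form_eqI) (simp add: is_standard_cycle_form_def)
  then show ?thesis
    by (simp add: x_chain_def contract_stars.simps star_letters_def)
qed


section \<open>Restriction to a set of letters\<close>

definition restriction :: "nat set \<Rightarrow> (nat list \<Rightarrow>\<^sub>0 real) \<Rightarrow> (nat list \<Rightarrow>\<^sub>0 real)" where
  "restriction B = linear_ext (\<lambda>w. dirac (filter (\<lambda>a. a \<in> B) w))"

lemma linear_restriction: "linear (restriction B)"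
  by (simp add: restriction_def linear_linear_ext)

lemma restriction_dirac: "restriction B (dirac w) = dirac (filter (\<lambda>a. a \<in> B) w)"
  by (simp add: restriction_def)

lemma linear_embed: "linear (embed n)"
  by (simp add: embed_def linear_linear_ext)

lemma embed_in_fun_space: "embed n x \<in> fun_space (words_on {1..n})"
  unfolding embed_def linear_ext_def
  by (intro subspace_sum subspace_scale subspace_fun_space indic_in_fun_space)
     (auto simp: perm_words_containing_def)

text \<open>
  The pairs of words that complete any word with content $A$ to a word with content $[n]$. They are the
  same for all words on $A$, which is what lets restriction interact with $H_A$.
\<close>

definition surroundings :: "nat \<Rightarrow> nat set \<Rightarrow> (nat list \<times> nat list) set" where
  "surroundings n A = {(u, v). u @ v \<in> words_on ({1..n} - A)}"

lemma finite_surroundings: "finite (surroundings n A)"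
proof -
  have "surroundings n A \<subseteq> {u. set u \<subseteq> {1..n} \<and> distinct u} \<times> {u. set u \<subseteq> {1..n} \<and> distinct u}"
    by (auto simp: surroundings_def words_on_def)
  then show ?thesis
    by (rule finite_subset) (intro finite_cartesian_product finite_subset_distinct; simp)
qed

lemma card_surroundings_pos: "card (surroundings n A) > 0"
proof -
  have "([], sorted_list_of_set ({1..n} - A)) \<in> surroundings n A"
    by (simp add: surroundings_def words_on_def)
  then show ?thesis
    using finite_surroundings by (auto simp: card_gt_0_iff)
qed

text \<open>
  Only for nonempty $w$ does $u w v$ determine the pair $(u, v)$; this is why $A = \emptyset$ is excluded.
\<close>

lemma indic_perm_words_containing:
  assumes w: "w \<in> words_on A" "A \<noteq> {}" "A \<subseteq> {1..n}"
  shows "indic (perm_words_containing n w) = (\<Sum>(u, v)\<in>surroundings n A. dirac (u @ w @ v))"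
proof -
  obtain p ps where p: "w = p # ps"
    using w(1,2) by (cases w) (auto simp: words_on_def)
  have inj: "inj_on (\<lambda>(u, v). u @ w @ v) (surroundings n A)"
  proof (rule inj_onI, clarify)
    fix u v u' v'
    assume "(u, v) \<in> surroundings n A" "(u', v') \<in> surroundings n A" and eq: "u @ w @ v = u' @ w @ v'"
    then have "p \<notin> set u" "p \<notin> set (ps @ v)"
      using w(1) by (auto simp: surroundings_def words_on_def p)
    then show "u = u' \<and> v = v'"
      using eq append_Cons_eq_iff[of p u "ps @ v" u' "ps @ v'"] by (simp add: p)
  qed
  have "perm_words_containing n w = (\<lambda>(u, v). u @ w @ v) ` surroundings n A"
  proof (intro equalityI subsetI)
    fix s assume "s \<in> perm_words_containing n w"
    then obtain u v where s: "s = u @ w @ v" "s \<in> words_on {1..n}"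
      by (auto simp: perm_words_containing_def)
    then have "(u, v) \<in> surroundings n A"
      using w(1) by (auto simp: surroundings_def words_on_def)
    then show "s \<in> (\<lambda>(u, v). u @ w @ v) ` surroundings n A"
      using s(1) by force
  next
    fix s assume "s \<in> (\<lambda>(u, v). u @ w @ v) ` surroundings n A"
    then obtain u v where s: "s = u @ w @ v" "(u, v) \<in> surroundings n A"
      by auto
    then have "u \<in> inj_words n" "v \<in> inj_words n" "s \<in> words_on {1..n}"
      using w(1,3) by (auto simp: surroundings_def words_on_def inj_words_def)
    then show "s \<in> perm_words_containing n w"
      using s(1) by (auto simp: perm_words_containing_def)
  qed
  then show ?thesis
    using sum.reindex[OF inj, of dirac] by (simp add: indic_def case_prod_unfold)
qed

lemma restriction_embed:
  assumes "h \<in> fun_space (words_on A)" "A \<noteq> {}" "A \<subseteq> {1..n}"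
  shows "restriction B (embed n h) =
    linear_ext (\<lambda>w. \<Sum>(u, v)\<in>surroundings n A. dirac (filter (\<lambda>a. a \<in> B) (u @ w @ v))) h"
proof -
  have "restriction B (embed n h) = linear_ext (\<lambda>w. restriction B (indic (perm_words_containing n w))) h"
    by (simp add: embed_def linear_ext_linear_compose[OF linear_restriction])
  also have "\<dots> = linear_ext (\<lambda>w. \<Sum>(u, v)\<in>surroundings n A. dirac (filter (\<lambda>a. a \<in> B) (u @ w @ v))) h"
    by (rule linear_ext_cong[OF assms(1)])
       (simp add: indic_perm_words_containing[OF _ assms(2,3)] linear_sum[OF linear_restriction]
          case_prod_unfold restriction_dirac)
  finally show ?thesis .
qed

text \<open>
  For $a \in A - B$, restricting $u w v$ to $B$ gives the same result when $a$ has first been deleted from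
  $w$. So the restriction factors through $\varrho_a$, which annihilates $h$.
\<close>

lemma restriction_embed_eq_0:
  assumes h: "h \<in> H_space A" and "A \<subseteq> {1..n}" "\<not> A \<subseteq> B"
  shows "restriction B (embed n h) = 0"
proof -
  obtain a where a: "a \<in> A" "a \<notin> B"
    using assms(3) by blast
  define F where "F = (\<lambda>w. \<Sum>(u, v)\<in>surroundings n A. dirac (filter (\<lambda>a. a \<in> B) (u @ w @ v)))"
  have "filter (\<lambda>a. a \<in> B) (removeAll a w) = filter (\<lambda>a. a \<in> B) w" for w
    using a(2) by (induction w) auto
  then have F: "F (removeAll a w) = F w" for w
    by (simp add: F_def)
  have "restriction B (embed n h) = linear_ext F h"
    unfolding F_def by (rule restriction_embed) (use h assms(2) a in \<open>auto simp: H_space_def\<close>)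
  also have "\<dots> = linear_ext F (deletion a h)"
    by (simp add: deletion_def linear_ext_dirac_compose F)
  also have "\<dots> = 0"
    using h a(1) by (simp add: H_space_def linear_ext_def)
  finally show ?thesis .
qed

lemma restriction_embed_self:
  assumes "h \<in> fun_space (words_on A)" "A \<noteq> {}" "A \<subseteq> {1..n}"
  shows "restriction A (embed n h) = real (card (surroundings n A)) *\<^sub>R h"
proof -
  have "restriction A (embed n h) =
      linear_ext (\<lambda>w. \<Sum>(u, v)\<in>surroundings n A. dirac (filter (\<lambda>a. a \<in> A) (u @ w @ v))) h"
    by (rule restriction_embed[OF assms])
  also have "\<dots> = linear_ext (\<lambda>w. \<Sum>p\<in>surroundings n A. dirac w) h"
  proof (rule linear_ext_cong[OF assms(1)], rule sum.cong)
    fix w p assume w: "w \<in> words_on A" and p: "p \<in> surroundings n A"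
    obtain u v where uv: "p = (u, v)" by force
    have "set u \<inter> A = {}" "set v \<inter> A = {}" "set w = A"
      using w p uv by (auto simp: surroundings_def words_on_def)
    then have "filter (\<lambda>a. a \<in> A) u = []" "filter (\<lambda>a. a \<in> A) v = []" "filter (\<lambda>a. a \<in> A) w = w"
      by (auto simp: filter_empty_conv filter_id_conv)
    then have "filter (\<lambda>a. a \<in> A) (u @ w @ v) = w"
      by simp
    then show "(case p of (u, v) \<Rightarrow> dirac (filter (\<lambda>a. a \<in> A) (u @ w @ v))) = dirac w"
      by (simp add: uv)
  qed simp
  also have "\<dots> = real (card (surroundings n A)) *\<^sub>R h"
    by (simp add: sum_constant_scaleR linear_ext_scaleR_dirac)
  finally show ?thesis .
qed


section \<open>The wavelet bases\<close>

lemma supp_subset: "\<tau> permutes S \<Longrightarrow> supp \<tau> \<subseteq> S"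
  unfolding supp_def using permutes_not_in by fastforce

lemma permutation_if_permutes_atLeastAtMost: "\<tau> permutes {1..n::nat} \<Longrightarrow> permutation \<tau>"
  by (rule permutation_permutes[THEN iffD2]) blast

lemma supp_eq_empty_iff: "supp \<tau> = {} \<longleftrightarrow> \<tau> = id"
  by (auto simp: supp_def)

lemma restriction_wavelet_eq_0:
  assumes "\<tau> permutes {1..n}" "\<not> supp \<tau> \<subseteq> B"
  shows "restriction B (wavelet n \<tau>) = 0"
proof -
  have "\<tau> \<noteq> id"
    using assms(2) supp_eq_empty_iff by blast
  then show ?thesis
    using restriction_embed_eq_0[OF x_chain_in_H_space supp_subset assms(2)] assms(1)
      permutation_if_permutes_atLeastAtMost
    by (simp add: wavelet_def)
qed

text \<open>
  The factor depends only on the support. The identity fits the same pattern with $B = \emptyset$ and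
  $x_{id}$ the empty word, but its factor is $n!$ instead of the number of surroundings.
\<close>

lemma restriction_wavelet_supp:
  "\<exists>r. r \<noteq> 0 \<and> (\<forall>\<tau>. \<tau> permutes {1..n} \<longrightarrow> supp \<tau> = B \<longrightarrow> restriction B (wavelet n \<tau>) = r *\<^sub>R x_chain \<tau>)"
proof (cases "B = {}")
  case True
  have "{1..n} \<in> range set"
    by (metis rangeI set_sorted_list_of_set finite_atLeastAtMost)
  then have "sorted_list_of_set {1..n} \<in> words_on {1..n}"
    by (simp add: words_on_def)
  then have "real (card (words_on {1..n})) \<noteq> 0"
    using finite_words_on[of "{1..n}"] by auto
  moreover have "restriction {} (wavelet n id) = real (card (words_on {1..n})) *\<^sub>R x_chain id"
    by (simp add: wavelet_def indic_def linear_sum[OF linear_restriction] restriction_dirac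
        x_chain_id sum_constant_scaleR)
  ultimately show ?thesis
    using True by (metis supp_eq_empty_iff)
next
  case False
  have "restriction B (wavelet n \<tau>) = real (card (surroundings n B)) *\<^sub>R x_chain \<tau>"
    if "\<tau> permutes {1..n}" "supp \<tau> = B" for \<tau>
  proof -
    have "\<tau> \<noteq> id"
      using False that(2) supp_eq_empty_iff by blast
    moreover have "x_chain \<tau> \<in> fun_space (words_on B)"
      using x_chain_in_H_space[OF permutation_if_permutes_atLeastAtMost[OF that(1)]] that(2)
      by (simp add: H_space_def)
    ultimately show ?thesis
      using restriction_embed_self[of _ B n] False supp_subset[OF that(1)] that(2)
      by (simp add: wavelet_def)
  qed
  then show ?thesis
    using card_surroundings_pos[of n B] by (intro exI[of _ "real (card (surroundings n B))"]) simp
qed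

lemma restriction_wavelet_combination:
  assumes "\<And>\<tau>. \<tau> permutes {1..n} \<Longrightarrow> supp \<tau> \<subset> B \<Longrightarrow> c \<tau> = 0"
  obtains r where "r \<noteq> 0"
    "restriction B (\<Sum>\<tau> | \<tau> permutes {1..n}. c \<tau> *\<^sub>R wavelet n \<tau>) =
       r *\<^sub>R (\<Sum>\<tau>\<in>perms_with_supp n B. c \<tau> *\<^sub>R x_chain \<tau>)"
proof -
  obtain r where r: "r \<noteq> 0"
    "\<And>\<tau>. \<tau> permutes {1..n} \<Longrightarrow> supp \<tau> = B \<Longrightarrow> restriction B (wavelet n \<tau>) = r *\<^sub>R x_chain \<tau>"
    using restriction_wavelet_supp[of n B] by blast
  have "restriction B (\<Sum>\<tau> | \<tau> permutes {1..n}. c \<tau> *\<^sub>R wavelet n \<tau>) =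
      (\<Sum>\<tau> | \<tau> permutes {1..n}. c \<tau> *\<^sub>R restriction B (wavelet n \<tau>))"
    by (simp add: linear_sum[OF linear_restriction] linear_scale[OF linear_restriction])
  also have "\<dots> = (\<Sum>\<tau>\<in>perms_with_supp n B. c \<tau> *\<^sub>R restriction B (wavelet n \<tau>))"
  proof (rule sum.mono_neutral_right)
    show "\<forall>\<tau>\<in>{\<tau>. \<tau> permutes {1..n}} - perms_with_supp n B. c \<tau> *\<^sub>R restriction B (wavelet n \<tau>) = 0"
    proof
      fix \<tau> assume \<tau>: "\<tau> \<in> {\<tau>. \<tau> permutes {1..n}} - perms_with_supp n B"
      then consider "supp \<tau> \<subset> B" | "\<not> supp \<tau> \<subseteq> B"
        by (auto simp: perms_with_supp_def)
      then show "c \<tau> *\<^sub>R restriction B (wavelet n \<tau>) = 0"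
        using \<tau> assms[of \<tau>] restriction_wavelet_eq_0[of \<tau> n B] by cases auto
    qed
  qed (auto simp: perms_with_supp_def intro: finite_permutations)
  also have "\<dots> = r *\<^sub>R (\<Sum>\<tau>\<in>perms_with_supp n B. c \<tau> *\<^sub>R x_chain \<tau>)"
    by (simp add: scaleR_sum_right r(2) perms_with_supp_def mult.commute)
  finally show ?thesis
    using r(1) that by blast
qed

lemma independent_x_chain:
  assumes "(\<Sum>\<tau>\<in>perms_with_supp n B. c \<tau> *\<^sub>R x_chain \<tau>) = 0" "\<tau> \<in> perms_with_supp n B"
  shows "c \<tau> = 0"
proof (rule independent_if_leading_words[OF _ _ _ assms])
  show "finite (perms_with_supp n B)"
    by (rule finite_subset[OF _ finite_permutations[of "{1..n}"]]) (auto simp: perms_with_supp_def)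
  show "leading_word (x_chain \<tau>) (chain_word \<tau>)" if "\<tau> \<in> perms_with_supp n B" for \<tau>
    using that permutation_if_permutes_atLeastAtMost
    by (intro leading_word_x_chain) (auto simp: perms_with_supp_def)
  show "inj_on chain_word (perms_with_supp n B)"
    by (rule inj_on_subset[OF inj_on_chain_word])
       (auto simp: perms_with_supp_def permutation_if_permutes_atLeastAtMost)
qed

text \<open>
  Wavelets with support not contained in $B$ vanish under restriction to $B$, those with support strictly
  inside $B$ have coefficient zero by induction, and the remaining chains are independent. Assuming only
  that the restrictions vanish, and not the sum itself, makes the lemma applicable to expansions of
  elements of $W_A$.
\<close>

lemma coefficient_eq_0_if_restrictions_eq_0:
  assumes "\<And>C. C \<subseteq> B \<Longrightarrow> restriction C (\<Sum>\<tau> | \<tau> permutes {1..n}. c \<tau> *\<^sub>R wavelet n \<tau>) = 0"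
    and "\<tau> permutes {1..n}" "supp \<tau> = B"
  shows "c \<tau> = 0"
proof -
  have "finite B"
    using supp_subset[OF assms(2)] assms(3) finite_subset by blast
  then show ?thesis
    using assms
  proof (induction B arbitrary: \<tau> rule: finite_psubset_induct)
    case (psubset B)
    have "c \<sigma> = 0" if "\<sigma> permutes {1..n}" "supp \<sigma> \<subset> B" for \<sigma>
      using psubset.IH[OF that(2) psubset.prems(1) that(1) refl] that(2) by blast
    then obtain r where "r \<noteq> 0"
      "restriction B (\<Sum>\<tau> | \<tau> permutes {1..n}. c \<tau> *\<^sub>R wavelet n \<tau>) =
         r *\<^sub>R (\<Sum>\<tau>\<in>perms_with_supp n B. c \<tau> *\<^sub>R x_chain \<tau>)"
      by (rule restriction_wavelet_combination)
    then have "(\<Sum>\<tau>\<in>perms_with_supp n B. c \<tau> *\<^sub>R x_chain \<tau>) = 0"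
      using psubset.prems(1)[OF subset_refl] by simp
    then show ?case
      by (rule independent_x_chain) (use psubset.prems in \<open>simp add: perms_with_supp_def\<close>)
  qed
qed

lemma basis_wavelet_fun_space:
  "basis_family (wavelet n) {\<tau>. \<tau> permutes {1..n}} (fun_space (words_on {1..n}))"
proof -
  let ?P = "{\<tau>. \<tau> permutes {1..n}}" and ?W = "words_on {1..n}"
  have fin: "finite ?P"
    by (simp add: finite_permutations)
  have zero: "c \<tau> = 0" if sum: "(\<Sum>\<tau>\<in>?P. c \<tau> *\<^sub>R wavelet n \<tau>) = 0" and \<tau>: "\<tau> \<in> ?P" for c \<tau>
  proof (rule coefficient_eq_0_if_restrictions_eq_0[OF _ CollectD[OF \<tau>] refl])
    show "restriction C (\<Sum>\<tau>\<in>?P. c \<tau> *\<^sub>R wavelet n \<tau>) = 0" for C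
      unfolding sum by (rule linear_0[OF linear_restriction])
  qed
  have inj: "inj_on (wavelet n) ?P"
    by (rule independent_familyI(1)[OF fin], rule zero)
  have ind: "independent (wavelet n ` ?P)"
    by (rule independent_familyI(2)[OF fin], rule zero)
  have "wavelet n \<tau> \<in> fun_space ?W" for \<tau>
    by (simp add: wavelet_def indic_in_fun_space embed_in_fun_space del: One_nat_def)
  then have sub: "wavelet n ` ?P \<subseteq> span (dirac ` ?W)"
    unfolding span_dirac by blast
  have "?W = permutations_of_set {1..n}"
    by (auto simp: words_on_def permutations_of_set_def)
  then have "card (dirac ` ?W) \<le> fact n"
    using card_image_le[OF finite_words_on, of "{1..n}" dirac] by simp
  also have "fact n = card (wavelet n ` ?P)"
    unfolding card_image[OF inj] using card_permutations[of "{1..n}" n] by simp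
  finally have "span (wavelet n ` ?P) = span (dirac ` ?W)"
    using ind sub by (intro span_eq_if_card_le) (simp_all add: finite_words_on)
  then show ?thesis
    using inj ind by (simp add: basis_family_def span_dirac)
qed

lemma subspace_H_space: "subspace (H_space A)"
  using subspace_fun_space[of "words_on A"]
  by (auto simp: H_space_def subspace_def linear_add[OF linear_deletion] linear_scale[OF linear_deletion]
      linear_0[OF linear_deletion])

text \<open>
  Independence is inherited from the full family. For spanning, restriction to $A$ removes the
  components of $\phi_n h$ on supports not contained in $A$, and recovers $h$ itself from those on $A$.
\<close>

lemma basis_wavelet_W_space:
  assumes A: "A \<subseteq> {1..n}" "A \<noteq> {}"
  shows "basis_family (wavelet n) (perms_with_supp n A) (W_space n A)"
proof -
  let ?P = "{\<tau>. \<tau> permutes {1..n}}" and ?D = "perms_with_supp n A"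
  have D: "?D \<subseteq> ?P"
    by (auto simp: perms_with_supp_def)
  have fin: "finite ?P"
    by (simp add: finite_permutations)
  have all: "inj_on (wavelet n) ?P" "independent (wavelet n ` ?P)"
    "span (wavelet n ` ?P) = fun_space (words_on {1..n})"
    using basis_wavelet_fun_space by (simp_all add: basis_family_def)
  have wav: "wavelet n \<tau> = embed n (x_chain \<tau>)" if "\<tau> \<in> ?D" for \<tau>
    using that A(2) supp_eq_empty_iff by (auto simp: wavelet_def perms_with_supp_def)
  have "wavelet n \<tau> \<in> W_space n A" if "\<tau> \<in> ?D" for \<tau>
    using wav[OF that] x_chain_in_H_space[of \<tau>] that permutation_if_permutes_atLeastAtMost
    by (auto simp: W_space_def perms_with_supp_def)
  then have "span (wavelet n ` ?D) \<subseteq> W_space n A"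
    unfolding W_space_def
    by (intro span_minimal linear_subspace_image linear_embed subspace_H_space) auto
  moreover have "W_space n A \<subseteq> span (wavelet n ` ?D)"
  proof
    fix y assume "y \<in> W_space n A"
    then obtain h where h: "h \<in> H_space A" "y = embed n h"
      by (auto simp: W_space_def)
    have "y \<in> fun_space (words_on {1..n})"
      unfolding h(2) by (rule embed_in_fun_space)
    then have "y \<in> span (wavelet n ` ?P)"
      unfolding all(3) .
    then obtain u where "y = (\<Sum>v\<in>wavelet n ` ?P. u v *\<^sub>R v)"
      using fin by (auto simp: span_finite)
    then have y: "y = (\<Sum>\<tau>\<in>?P. u (wavelet n \<tau>) *\<^sub>R wavelet n \<tau>)"
      by (simp only: sum.reindex[OF all(1)] o_def)
    define c where "c = (\<lambda>\<tau>. u (wavelet n \<tau>))"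
    have yc: "(\<Sum>\<tau>\<in>?P. c \<tau> *\<^sub>R wavelet n \<tau>) = y"
      unfolding c_def y ..
    have "c \<tau> = 0" if \<tau>: "\<tau> permutes {1..n}" "supp \<tau> \<subset> A" for \<tau>
    proof (rule coefficient_eq_0_if_restrictions_eq_0[OF _ \<tau>(1) refl])
      fix C assume "C \<subseteq> supp \<tau>"
      then have "\<not> A \<subseteq> C"
        using \<tau>(2) by blast
      then show "restriction C (\<Sum>\<tau>\<in>?P. c \<tau> *\<^sub>R wavelet n \<tau>) = 0"
        unfolding yc h(2) by (rule restriction_embed_eq_0[OF h(1) A(1)])
    qed
    then obtain r where r: "restriction A y = r *\<^sub>R (\<Sum>\<tau>\<in>?D. c \<tau> *\<^sub>R x_chain \<tau>)"
      using restriction_wavelet_combination[of n A c] unfolding yc by metis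
    (* Restriction to A yields multiples of both h and its expansion; embedding recovers y. *)
    define s where "s = real (card (surroundings n A))"
    have "s \<noteq> 0"
      using card_surroundings_pos[of n A] by (simp add: s_def)
    have "s *\<^sub>R h = r *\<^sub>R (\<Sum>\<tau>\<in>?D. c \<tau> *\<^sub>R x_chain \<tau>)"
      using restriction_embed_self[of h A n] h A r by (simp add: H_space_def s_def)
    then have "embed n (s *\<^sub>R h) = embed n (r *\<^sub>R (\<Sum>\<tau>\<in>?D. c \<tau> *\<^sub>R x_chain \<tau>))"
      by (rule arg_cong)
    then have "s *\<^sub>R y = r *\<^sub>R (\<Sum>\<tau>\<in>?D. c \<tau> *\<^sub>R wavelet n \<tau>)"
      by (simp add: h(2) wav linear_scale[OF linear_embed] linear_sum[OF linear_embed])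
    also have "\<dots> \<in> span (wavelet n ` ?D)"
      by (intro span_scale span_sum span_base) auto
    finally show "y \<in> span (wavelet n ` ?D)"
      using \<open>s \<noteq> 0\<close> span_scale[of "s *\<^sub>R y" _ "1 / s"] by simp
  qed
  ultimately show ?thesis
    using inj_on_subset[OF all(1) D] independent_mono[OF all(2) image_mono[OF D]]
    by (simp add: basis_family_def)
qed

theorem theorem5:
  fixes n :: nat
  assumes "n \<ge> 2"
  shows "(\<forall>A. A \<subseteq> {1..n} \<and> card A \<ge> 2 \<longrightarrow>
            basis_family (wavelet n) (perms_with_supp n A) (W_space n A)) \<and>
         basis_family (wavelet n) {\<tau>. \<tau> permutes {1..n}} (fun_space (words_on {1..n}))"
proof (intro conjI allI impI)
  fix A :: "nat set" assume "A \<subseteq> {1..n} \<and> 2 \<le> card A"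
  then show "basis_family (wavelet n) (perms_with_supp n A) (W_space n A)"
    by (intro basis_wavelet_W_space) auto
qed (rule basis_wavelet_fun_space)

end
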